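(* Let $I\subset\mathbb{R}$ be a set which contains at least two incommensurable points $\omega_1,\omega_2\in I\setminus\{0\}$ (that is, $\frac{\omega_1}{\omega_2}\in\mathbb{R}\setminus\mathbb{Q}$). Let $n_1,n_1',\tilde n_1,\tilde n_1':\mathbb{R}\to\mathbb{C}$ be functions and $z_1,\tilde z_1\in\mathbb{R}$ such that $n_1'(\omega)\ne0$ and $\tilde n_1'(\omega)\ne0$ for all $\omega\in I$, and $$ m_0[n_1,n_1',z_1](\omega,\delta) = m_0[\tilde n_1,\tilde n_1',\tilde z_1](\omega,\delta)\quad\text{for all }\omega\in I,\ \delta\in\mathbb{R}. $$ Then $$ n_1(\omega)=\tilde n_1(\omega),\quad n_1'(\omega)=\tilde n_1'(\omega),\quad\text{and}\quad z_1=\tilde z_1\quad\text{for all }\omega\in I. $$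
   Context: Let $c>0$ denote the speed of light. The prime in $n_1'$ does not denote a derivative in $\omega$; $n_1'$ is an independent function (the rate of change of the refractive index under compression). For functions $n_1,n_1':\mathbb{R}\to\mathbb{C}$ and $z_1\in\mathbb{R}$, set $\bar n_1(\omega,\delta)=n_1(\omega)+\delta n_1'(\omega)$ (the refractive index of the first layer at the compression state $\delta\in\mathbb{R}$), and define the data $$ m_0[n_1,n_1',z_1](\omega,\delta)=\frac{\bar n_1(\omega,\delta)-1}{\bar n_1(\omega,\delta)+1}\,e^{-2i\frac{\omega}{c}z_1}. $$ The quantities with a tilde define $m_0[\tilde n_1,\tilde n_1',\tilde z_1]$ by the same formula. *)

theory Defs
  imports Complex_Main
begin

definition nbar :: "(real \<Rightarrow> complex) \<Rightarrow> (real \<Rightarrow> complex) \<Rightarrow> real \<Rightarrow> real \<Rightarrow> complex" where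
  "nbar n n' \<omega> \<delta> = n \<omega> + of_real \<delta> * n' \<omega>"

(* The first argument is the speed of light. n' is an independent function, not the derivative of n.
   Where nbar n n' \<omega> \<delta> = - 1 (for n' \<omega> \<noteq> 0, at most one \<delta>) the fraction is mathematically
   undefined; here it has the value 0, as division by 0 is total. In particular, two data that are
   undefined at the same point count as equal there. *)
definition m0 :: "real \<Rightarrow> (real \<Rightarrow> complex) \<Rightarrow> (real \<Rightarrow> complex) \<Rightarrow> real \<Rightarrow> real \<Rightarrow> real \<Rightarrow> complex" where
  "m0 c n n' z \<omega> \<delta> =
     (nbar n n' \<omega> \<delta> - 1) / (nbar n n' \<omega> \<delta> + 1) * exp (- 2 * \<i> * of_real (\<omega> / c) * of_real z)"

end

theory Submission
  imports Defs "HOL-Analysis.Complex_Transcendental"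
begin

text \<open>
  Write \<open>r x = (x - 1) / (x + 1)\<close> for the reflection coefficient and fix a frequency \<open>\<omega>\<close>.
  Because \<open>n1' \<omega> \<noteq> 0\<close>, the compressed index \<open>n1 \<omega> + \<delta> * n1' \<omega>\<close> leaves every bounded set as
  \<open>\<delta> \<rightarrow> \<infinity>\<close>, so its reflection coefficient tends to \<open>1\<close> and the data tend to the bare phase factor
  (lemma \<open>m0_tendsto_phase\<close>). Equal data therefore have equal phase factors. The phase is
  never zero and can be cancelled. For large \<open>\<delta>\<close> both indices avoid the pole \<open>-1\<close> of the Moebius
  transformation \<open>r\<close>, which is injective away from it, so they agree for all large
  \<open>\<delta>\<close>; and an affine function of \<open>\<delta>\<close> is determined by two of its values (lemma \<open>m0_eq_imp_index_eq\<close>).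

  At a single nonzero frequency, equality of the phases determines \<open>z1 - zt1\<close> only up to an integer
  multiple of \<open>\<pi> * c / \<omega>\<close>. For two incommensurable frequencies the only common multiple is \<open>0\<close>
  (lemma \<open>zero_if_two_incommensurable_phases_trivial\<close>).
\<close>

abbreviation phase :: "real \<Rightarrow> real \<Rightarrow> real \<Rightarrow> complex" where
  "phase c z \<omega> \<equiv> exp (- 2 * \<i> * of_real (\<omega> / c) * of_real z)"

lemma filterlim_nbar_at_infinity:
  assumes "n' \<omega> \<noteq> 0"
  shows "filterlim (nbar n n' \<omega>) at_infinity at_top"
proof -
  have "filterlim (\<lambda>\<delta>::real. complex_of_real \<delta>) at_infinity at_top"
    by (rule filterlim_of_real_at_infinity)
  hence "filterlim (\<lambda>\<delta>::real. complex_of_real \<delta> * n' \<omega>) at_infinity at_top"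
    using tendsto_mult_filterlim_at_infinity[OF tendsto_const assms] by (simp add: mult.commute)
  hence "filterlim (\<lambda>\<delta>::real. n \<omega> + complex_of_real \<delta> * n' \<omega>) at_infinity at_top"
    by (rule tendsto_add_filterlim_at_infinity[OF tendsto_const])
  thus ?thesis by (simp add: nbar_def[abs_def])
qed

lemma eventually_nbar_neq:
  assumes "n' \<omega> \<noteq> 0"
  shows "eventually (\<lambda>\<delta>. nbar n n' \<omega> \<delta> \<noteq> a) at_top"
  using assms by (intro filterlim_at_infinity_imp_eventually_ne filterlim_nbar_at_infinity)

text \<open>
  The reflection coefficient is \<open>1 - 2 / (x + 1)\<close>, which tends to \<open>1\<close> as \<open>x\<close> tends to infinity.
\<close>
lemma m0_tendsto_phase:
  assumes "n' \<omega> \<noteq> 0"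
  shows "(m0 c n n' z \<omega> \<longlongrightarrow> phase c z \<omega>) at_top"
proof -
  have "filterlim (\<lambda>\<delta>. nbar n n' \<omega> \<delta> + 1) at_infinity at_top"
    using tendsto_add_filterlim_at_infinity[OF tendsto_const filterlim_nbar_at_infinity[of n', OF assms]]
    by (simp add: add.commute)
  hence "((\<lambda>\<delta>. 2 / (nbar n n' \<omega> \<delta> + 1)) \<longlongrightarrow> 0) at_top"
    by (rule tendsto_divide_0[OF tendsto_const])
  hence "((\<lambda>\<delta>. (1 - 2 / (nbar n n' \<omega> \<delta> + 1)) * phase c z \<omega>) \<longlongrightarrow> (1 - 0) * phase c z \<omega>) at_top"
    by (intro tendsto_intros)
  moreover have "eventually (\<lambda>\<delta>. (1 - 2 / (nbar n n' \<omega> \<delta> + 1)) * phase c z \<omega>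
                    = m0 c n n' z \<omega> \<delta>) at_top"
    using eventually_nbar_neq[of n', OF assms, of n "-1"]
  proof eventually_elim
    case (elim \<delta>)
    hence "nbar n n' \<omega> \<delta> + 1 \<noteq> 0" by (simp add: add_eq_0_iff2)
    hence "1 - 2 / (nbar n n' \<omega> \<delta> + 1) = (nbar n n' \<omega> \<delta> - 1) / (nbar n n' \<omega> \<delta> + 1)"
      by (simp add: field_simps)
    thus ?case by (simp add: m0_def)
  qed
  ultimately show ?thesis
    by (auto elim: Lim_transform_eventually)
qed

lemma m0_eq_imp_phase_eq:
  assumes "n' \<omega> \<noteq> 0" "nt' \<omega> \<noteq> 0"
    and "\<And>\<delta>. m0 c n n' z \<omega> \<delta> = m0 c nt nt' zt \<omega> \<delta>"
  shows "phase c z \<omega> = phase c zt \<omega>"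
proof -
  have "m0 c n n' z \<omega> = m0 c nt nt' zt \<omega>"
    using assms(3) by (rule ext)
  thus ?thesis
    using m0_tendsto_phase[of n' \<omega> c n z, OF assms(1)] m0_tendsto_phase[of nt' \<omega> c nt zt, OF assms(2)]
      tendsto_unique[OF trivial_limit_at_top_linorder] by metis
qed

lemma reflection_coefficient_inj:
  fixes x y :: complex
  assumes "x \<noteq> - 1" "y \<noteq> - 1" "(x - 1) / (x + 1) = (y - 1) / (y + 1)"
  shows "x = y"
proof -
  have "x + 1 \<noteq> 0" "y + 1 \<noteq> 0" using assms(1,2) by (auto simp: add_eq_0_iff2)
  hence "(x - 1) * (y + 1) = (y - 1) * (x + 1)"
    using assms(3) by (simp add: frac_eq_eq)
  hence "2 * x = 2 * y" by (simp add: algebra_simps)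
  thus ?thesis by simp
qed

lemma m0_eq_imp_index_eq:
  assumes "n' \<omega> \<noteq> 0" "nt' \<omega> \<noteq> 0"
    and eq: "\<And>\<delta>. m0 c n n' z \<omega> \<delta> = m0 c nt nt' zt \<omega> \<delta>"
  shows "n \<omega> = nt \<omega> \<and> n' \<omega> = nt' \<omega>"
proof -
  have phase: "phase c z \<omega> = phase c zt \<omega>"
    using m0_eq_imp_phase_eq[of n' \<omega> nt', OF assms] .
  have "eventually (\<lambda>\<delta>. nbar n n' \<omega> \<delta> = nbar nt nt' \<omega> \<delta>) at_top"
    using eventually_nbar_neq[of n', OF assms(1), of n "-1"]
      eventually_nbar_neq[of nt', OF assms(2), of nt "-1"]
  proof eventually_elim
    case (elim \<delta>)
    have "(nbar n n' \<omega> \<delta> - 1) / (nbar n n' \<omega> \<delta> + 1)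
        = (nbar nt nt' \<omega> \<delta> - 1) / (nbar nt nt' \<omega> \<delta> + 1)"
      using eq[of \<delta>] unfolding m0_def phase
      by (simp only: mult_cancel_right exp_not_eq_zero simp_thms)
    thus ?case by (rule reflection_coefficient_inj[OF elim])
  qed
  then obtain d where d: "\<And>\<delta>. \<delta> \<ge> d \<Longrightarrow> nbar n n' \<omega> \<delta> = nbar nt nt' \<omega> \<delta>"
    by (auto simp: eventually_at_top_linorder)
  have at_d: "n \<omega> + of_real d * n' \<omega> = nt \<omega> + of_real d * nt' \<omega>"
    using d[of d] by (simp add: nbar_def)
  have "n \<omega> + of_real (d + 1) * n' \<omega> = nt \<omega> + of_real (d + 1) * nt' \<omega>"
    using d[of "d + 1"] by (simp add: nbar_def)
  hence "(n \<omega> + of_real d * n' \<omega>) + n' \<omega> = (nt \<omega> + of_real d * nt' \<omega>) + nt' \<omega>"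
    by (simp add: algebra_simps)
  hence "n' \<omega> = nt' \<omega>" using at_d by simp
  thus ?thesis using at_d by simp
qed

lemma phase_eq_imp_int_multiple_pi:
  assumes "phase c z \<omega> = phase c zt \<omega>"
  shows "\<exists>k::int. \<omega> / c * (z - zt) = of_int k * pi"
proof -
  obtain k :: int where k: "- 2 * \<i> * of_real (\<omega> / c) * of_real z
      = - 2 * \<i> * of_real (\<omega> / c) * of_real zt + of_int (2 * k) * pi * \<i>"
    using assms by (auto simp: exp_eq)
  have "- 2 * (\<omega> / c) * z = - 2 * (\<omega> / c) * zt + 2 * of_int k * pi"
    using arg_cong[OF k, of Im] by simp
  hence "2 * (\<omega> / c * (z - zt)) = 2 * (of_int (- k) * pi)"
    by (simp add: right_diff_distrib diff_divide_distrib mult_ac)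
  hence "\<omega> / c * (z - zt) = of_int (- k) * pi" by linarith
  thus ?thesis by blast
qed

text \<open>
  If \<open>d \<noteq> 0\<close>, then \<open>\<omega>1 / \<omega>2 = (\<omega>1 / c * d) / (\<omega>2 / c * d) = k1 / k2\<close> would be rational.
\<close>
lemma zero_if_two_incommensurable_phases_trivial:
  fixes c d \<omega>1 \<omega>2 :: real
  assumes "c \<noteq> 0" "\<omega>1 / \<omega>2 \<notin> \<rat>"
    and "\<omega>1 / c * d = of_int k1 * pi" "\<omega>2 / c * d = of_int k2 * pi"
  shows "d = 0"
proof (rule ccontr)
  assume "d \<noteq> 0"
  hence "\<omega>1 / \<omega>2 = (\<omega>1 / c * d) / (\<omega>2 / c * d)" using assms(1) by simp
  also have "\<dots> = of_int k1 / of_int k2" unfolding assms(3,4) by simp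
  also have "\<dots> \<in> \<rat>" by simp
  finally show False using assms(2) by simp
qed

theorem lemma5p1:
  fixes c :: real
    and I :: "real set"
    and n1 n1' nt1 nt1' :: "real \<Rightarrow> complex"
    and z1 zt1 :: real
  assumes "c > 0"
    and "\<exists>\<omega>1 \<in> I - {0}. \<exists>\<omega>2 \<in> I - {0}. \<omega>1 / \<omega>2 \<notin> \<rat>"
    and "\<forall>\<omega>\<in>I. n1' \<omega> \<noteq> 0"
    and "\<forall>\<omega>\<in>I. nt1' \<omega> \<noteq> 0"
    and "\<forall>\<omega>\<in>I. \<forall>\<delta>::real. m0 c n1 n1' z1 \<omega> \<delta> = m0 c nt1 nt1' zt1 \<omega> \<delta>"
  shows "(\<forall>\<omega>\<in>I. n1 \<omega> = nt1 \<omega> \<and> n1' \<omega> = nt1' \<omega>) \<and> z1 = zt1"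
proof
  show "\<forall>\<omega>\<in>I. n1 \<omega> = nt1 \<omega> \<and> n1' \<omega> = nt1' \<omega>"
  proof
    fix \<omega> assume "\<omega> \<in> I"
    thus "n1 \<omega> = nt1 \<omega> \<and> n1' \<omega> = nt1' \<omega>"
      using assms(3-5) by (intro m0_eq_imp_index_eq[of n1' \<omega> nt1' c n1 z1 nt1 zt1]) auto
  qed
next
  have shift: "\<exists>k::int. \<omega> / c * (z1 - zt1) = of_int k * pi" if "\<omega> \<in> I" for \<omega>
    using that assms(3-5)
    by (intro phase_eq_imp_int_multiple_pi m0_eq_imp_phase_eq[of n1' \<omega> nt1' c n1 z1 nt1 zt1]) auto
  obtain \<omega>1 \<omega>2 where \<omega>: "\<omega>1 \<in> I" "\<omega>2 \<in> I" "\<omega>1 / \<omega>2 \<notin> \<rat>"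
    using assms(2) by auto
  obtain k1 k2 :: int where "\<omega>1 / c * (z1 - zt1) = of_int k1 * pi" "\<omega>2 / c * (z1 - zt1) = of_int k2 * pi"
    using shift[OF \<omega>(1)] shift[OF \<omega>(2)] by auto
  hence "z1 - zt1 = 0"
    using assms(1) \<omega>(3)
    by (intro zero_if_two_incommensurable_phases_trivial[of c \<omega>1 \<omega>2 "z1 - zt1" k1 k2]) simp_all
  thus "z1 = zt1" by simp
qed

end
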